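(* Let $D=(d_1,\dots,d_n)$ be a graphic degree sequence. Then (a) $\max\big(|\mathbb G(\mathcal D^{++}_D)|,|\mathbb G(\mathcal D^{--}_D)|\big)\le n^2\big(|\mathbb G(\mathcal D^{+-}_D)|+|\mathcal G(D)|\big)$; (b) $\max\big(|\mathbb G(\mathcal D^{+2}_D)|,|\mathbb G(\mathcal D^{-2}_D)|\big)\le n^2\,|\mathbb G(\mathcal D^{+-}_D)|$; (c) $|\mathbb G(\mathcal D^{+-}_D)|\le (n^4+n^2)\min\big(|\mathbb G(\mathcal D^{++}_D)|,|\mathbb G(\mathcal D^{--}_D)|\big)$.
   Context: For an integer sequence $E$ of length $n$, $\mathcal G(E)$ is the set of simple graphs on the labelled vertex set $\{v_1,\dots,v_n\}$ with $\deg(v_i)=e_i$ (empty if some entry is negative); for a family $\mathcal F$ of sequences, $\mathbb G(\mathcal F)=\bigcup_{E\in\mathcal F}\mathcal G(E)$. For indices $i,j$, $1^{\pm i}_{\pm j}$ denotes the vector with $\pm1$ added at coordinate $i$ and $\pm1$ at coordinate $j$ (zeros elsewhere). Define $\mathcal D^{+-}_D=\{D+1^{+i}_{-j}:1\le i\ne j\le n\}$, $\mathcal D^{++}_D=\{D+1^{+i}_{+j}:1\le i\ne j\le n\}$, $\mathcal D^{--}_D=\{D+1^{-i}_{-j}:1\le i\ne j\le n\}$, $\mathcal D^{+2}_D=\{D+1^{+i}_{+i}:1\le i\le n\}$ (adding $2$ to coordinate $i$), $\mathcal D^{-2}_D=\{D+1^{-i}_{-i}:1\le i\le n\}$. *)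

theory Defs
  imports Main
begin

text \<open>
  The vertices v_1, ..., v_n are represented by the indices 0, ..., n - 1. As the labelled vertex
  set is determined by the length of the sequence, a simple graph is given by its edge set.
\<close>

definition vertex_pairs :: "nat \<Rightarrow> nat set set" where
  "vertex_pairs n = {{u, v} | u v. u < n \<and> v < n \<and> u \<noteq> v}"

definition degree :: "nat set set \<Rightarrow> nat \<Rightarrow> nat" where
  "degree H v = card {e \<in> H. v \<in> e}"

definition realizations :: "int list \<Rightarrow> nat set set set" where
  "realizations E = {H. H \<subseteq> vertex_pairs (length E) \<and>
                        (\<forall>i < length E. int (degree H i) = E ! i)}"

definition graphs_of :: "int list set \<Rightarrow> nat set set set" where
  "graphs_of F = (\<Union>E\<in>F. realizations E)"

definition graphic :: "int list \<Rightarrow> bool" where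
  "graphic D \<longleftrightarrow> realizations D \<noteq> {}"

text \<open>
  For \<open>i = j\<close> the two summands accumulate, so \<open>perturb D 1 i 1 i\<close> adds 2 to coordinate \<open>i\<close>.
\<close>

definition perturb :: "int list \<Rightarrow> int \<Rightarrow> nat \<Rightarrow> int \<Rightarrow> nat \<Rightarrow> int list" where
  "perturb D s i t j =
     map (\<lambda>k. D ! k + (if k = i then s else 0) + (if k = j then t else 0)) [0..<length D]"

definition seqs_plus_minus :: "int list \<Rightarrow> int list set" where
  "seqs_plus_minus D = {perturb D 1 i (-1) j | i j. i < length D \<and> j < length D \<and> i \<noteq> j}"

definition seqs_plus_plus :: "int list \<Rightarrow> int list set" where
  "seqs_plus_plus D = {perturb D 1 i 1 j | i j. i < length D \<and> j < length D \<and> i \<noteq> j}"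

definition seqs_minus_minus :: "int list \<Rightarrow> int list set" where
  "seqs_minus_minus D = {perturb D (-1) i (-1) j | i j. i < length D \<and> j < length D \<and> i \<noteq> j}"

definition seqs_plus_two :: "int list \<Rightarrow> int list set" where
  "seqs_plus_two D = {perturb D 1 i 1 i | i. i < length D}"

definition seqs_minus_two :: "int list \<Rightarrow> int list set" where
  "seqs_minus_two D = {perturb D (-1) i (-1) i | i. i < length D}"

text \<open>
  All graph families over sequences of a fixed length are finite, so \<open>card\<close> is the genuine number of graphs.
\<close>

lemma finite_vertex_pairs: "finite (vertex_pairs n)"
proof -
  have "vertex_pairs n \<subseteq> Pow {..<n}"
    by (auto simp: vertex_pairs_def)
  then show ?thesis
    by (rule finite_subset) simp
qed

lemma finite_realizations: "finite (realizations E)"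
proof -
  have "realizations E \<subseteq> Pow (vertex_pairs (length E))"
    by (auto simp: realizations_def)
  then show ?thesis
    by (rule finite_subset) (simp add: finite_vertex_pairs)
qed

lemma finite_graphs_of:
  assumes "\<And>E. E \<in> F \<Longrightarrow> length E = n"
  shows "finite (graphs_of F)"
proof -
  have "graphs_of F \<subseteq> Pow (vertex_pairs n)"
    using assms by (auto simp: graphs_of_def realizations_def)
  then show ?thesis
    by (rule finite_subset) (simp add: finite_vertex_pairs)
qed

end

theory Submission
  imports Defs
begin

text \<open>
  Each bound comes from an injection up to a bounded number of parameters. Removing any edge at a
  vertex of excess degree turns a graph over \<open>D + 1\<^sub>i + 1\<^sub>j\<close> or \<open>D + 2\<^sub>i\<close> into one over \<open>D\<close> or
  \<open>D + 1\<^sub>i - 1\<^sub>w\<close>, and the removed edge is the only information lost. Conversely, let \<open>G\<close> have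
  degrees \<open>D + 1\<^sub>i - 1\<^sub>j\<close>. If \<open>j\<close> has a non-neighbour \<open>k \<noteq> i\<close>, add the edge \<open>jk\<close>. Otherwise \<open>ij\<close> is
  not an edge; add it, and then replace an edge \<open>iw\<close> by a non-edge \<open>wx\<close> with \<open>x \<noteq> i\<close>. If there were no
  such \<open>w\<close>, all \<open>d\<^sub>i + 2\<close> neighbours of \<open>i\<close> would have full degree, also in a realization of \<open>D\<close>,
  where \<open>i\<close> has only \<open>d\<^sub>i\<close> neighbours. The three remaining bounds follow by taking complements.
\<close>

section \<open>Degrees in subgraphs of the complete graph\<close>

lemma doubleton_mem_vertex_pairs [simp]: "{u, v} \<in> vertex_pairs n \<longleftrightarrow> u < n \<and> v < n \<and> u \<noteq> v"
  by (auto simp: vertex_pairs_def doubleton_eq_iff)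

lemma vertex_pairs_other_end:
  assumes "e \<in> vertex_pairs n" "v \<in> e"
  obtains u where "e = {v, u}" "u < n" "u \<noteq> v" "v < n"
  using assms by (auto simp: vertex_pairs_def)

lemma finite_subgraph: "H \<subseteq> vertex_pairs n \<Longrightarrow> finite H"
  by (rule finite_subset[OF _ finite_vertex_pairs])

lemma star_vertex_pairs:
  assumes "v < n"
  shows "{e \<in> vertex_pairs n. v \<in> e} = (\<lambda>u. {v, u}) ` ({..<n} - {v})"
  using assms by (auto elim!: vertex_pairs_other_end)

lemma degree_vertex_pairs:
  assumes "v < n"
  shows "degree (vertex_pairs n) v = n - 1"
proof -
  have "inj_on (\<lambda>u. {v, u}) ({..<n} - {v})"
    by (auto simp: inj_on_def doubleton_eq_iff)
  then show ?thesis
    using assms by (simp add: degree_def star_vertex_pairs card_image)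
qed

lemma degree_mono: "H \<subseteq> K \<Longrightarrow> finite K \<Longrightarrow> degree H v \<le> degree K v"
  unfolding degree_def by (rule card_mono) auto

lemma degree_le:
  assumes "H \<subseteq> vertex_pairs n" "v < n"
  shows "degree H v \<le> n - 1"
  using degree_mono[OF assms(1) finite_vertex_pairs] degree_vertex_pairs[OF assms(2)] by metis

text \<open>A subset of the finite star of \<open>v\<close> with equally many edges is the whole
  star. Adjacency can thus be read off from a degree alone, which is how it is later carried from
  one graph to another.\<close>

lemma full_degree_iff:
  assumes "H \<subseteq> vertex_pairs n" "v < n"
  shows "degree H v = n - 1 \<longleftrightarrow> (\<forall>u<n. u \<noteq> v \<longrightarrow> {v, u} \<in> H)"
proof
  assume "degree H v = n - 1"
  then have "card {e \<in> H. v \<in> e} = card {e \<in> vertex_pairs n. v \<in> e}"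
    using degree_vertex_pairs[OF assms(2)] by (simp add: degree_def)
  then have "{e \<in> H. v \<in> e} = {e \<in> vertex_pairs n. v \<in> e}"
    using assms(1) by (intro card_subset_eq) (auto simp: finite_vertex_pairs)
  then show "\<forall>u<n. u \<noteq> v \<longrightarrow> {v, u} \<in> H"
    using assms(2) by (auto simp: star_vertex_pairs)
next
  assume "\<forall>u<n. u \<noteq> v \<longrightarrow> {v, u} \<in> H"
  then have "{e \<in> H. v \<in> e} = {e \<in> vertex_pairs n. v \<in> e}"
    using assms by (auto elim!: vertex_pairs_other_end)
  then show "degree H v = n - 1"
    using degree_vertex_pairs[OF assms(2)] by (simp add: degree_def)
qed

text \<open>Phrased over \<open>int\<close> to avoid truncated subtraction; it serves both edge
  deletion and complements.\<close>

lemma degree_Diff: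
  assumes "finite K" "H \<subseteq> K"
  shows "int (degree (K - H) v) = int (degree K v) - int (degree H v)"
proof -
  have "{e \<in> K - H. v \<in> e} = {e \<in> K. v \<in> e} - {e \<in> H. v \<in> e}" by auto
  moreover have "card ({e \<in> K. v \<in> e} - {e \<in> H. v \<in> e})
      = card {e \<in> K. v \<in> e} - card {e \<in> H. v \<in> e}"
    using assms by (intro card_Diff_subset) (auto intro: finite_subset)
  ultimately show ?thesis
    using degree_mono[OF assms(2,1), of v] by (simp add: degree_def of_nat_diff)
qed

lemma degree_single:
  assumes "u \<noteq> v"
  shows "int (degree {{u, v}} k) = (if k = u then 1 else 0) + (if k = v then 1 else 0)"
proof -
  have "{e \<in> {{u, v}}. k \<in> e} = (if k = u \<or> k = v then {{u, v}} else {})" by auto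
  then show ?thesis using assms by (simp add: degree_def)
qed

lemma degree_delete:
  assumes "finite H" "{u, v} \<in> H" "u \<noteq> v"
  shows "int (degree (H - {{u, v}}) k)
           = int (degree H k) - (if k = u then 1 else 0) - (if k = v then 1 else 0)"
  using degree_Diff[of H "{{u, v}}" k] degree_single[of u v k] assms by simp

lemma degree_insert:
  assumes "finite H" "{u, v} \<notin> H" "u \<noteq> v"
  shows "int (degree (insert {u, v} H) k)
           = int (degree H k) + (if k = u then 1 else 0) + (if k = v then 1 else 0)"
  using degree_delete[of "insert {u, v} H" u v k] assms by simp

lemma degree_pos_neighbour:
  assumes "H \<subseteq> vertex_pairs n" "degree H v > 0"
  obtains u where "{v, u} \<in> H" "u < n" "u \<noteq> v"
proof -
  obtain e where "e \<in> H" "v \<in> e"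
    using assms(2) unfolding degree_def by (metis (no_types, lifting) card_gt_0_iff
        empty_Collect_eq)
  with assms(1) that show thesis by (metis subsetD vertex_pairs_other_end)
qed

section \<open>Perturbed sequences and counting up to parameters\<close>

lemma length_perturb [simp]: "length (perturb D s i t j) = length D"
  by (simp add: perturb_def)

lemma realizations_perturb_iff:
  "H \<in> realizations (perturb D s i t j) \<longleftrightarrow> H \<subseteq> vertex_pairs (length D) \<and>
     (\<forall>k<length D. int (degree H k) = D ! k + (if k = i then s else 0) + (if k = j then t else 0))"
  by (auto simp: realizations_def perturb_def)

lemma graphs_of_plus_minus:
  "graphs_of (seqs_plus_minus D)
     = (\<Union>i<length D. \<Union>j\<in>{..<length D} - {i}. realizations (perturb D 1 i (-1) j))"
  by (auto simp: graphs_of_def seqs_plus_minus_def)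

lemma graphs_of_plus_plus:
  "graphs_of (seqs_plus_plus D)
     = (\<Union>i<length D. \<Union>j\<in>{..<length D} - {i}. realizations (perturb D 1 i 1 j))"
  by (auto simp: graphs_of_def seqs_plus_plus_def)

lemma graphs_of_plus_two:
  "graphs_of (seqs_plus_two D) = (\<Union>i<length D. realizations (perturb D 1 i 1 i))"
  by (auto simp: graphs_of_def seqs_plus_two_def)

text \<open>Here \<open>f\<close> is a decoder: \<open>p\<close> holds the information lost in
  passing from \<open>a\<close> to \<open>b\<close>. Decodability alone covers \<open>A\<close> by
  the image of \<open>P \<times> B\<close>.\<close>

lemma card_le_parametrized:
  assumes "finite P" "finite B" "\<And>a. a \<in> A \<Longrightarrow> \<exists>p\<in>P. \<exists>b\<in>B. a = f p b"
  shows "card A \<le> card P * card B"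
proof -
  have "A \<subseteq> (\<lambda>(p, b). f p b) ` (P \<times> B)"
    using assms(3) by fastforce
  then show ?thesis
    using surj_card_le[of "P \<times> B" A "\<lambda>(p, b). f p b"] assms(1,2) by (simp add: card_cartesian_product)
qed

text \<open>Reinserting the edge recovers \<open>G\<close>; the factor \<open>n\<^sup>2\<close>
  counts ordered pairs of possible ends.\<close>

lemma card_le_delete_edge:
  assumes "finite B"
    and "\<And>G. G \<in> A \<Longrightarrow> \<exists>u<n. \<exists>v<n. {u, v} \<in> G \<and> G - {{u, v}} \<in> B"
  shows "card A \<le> n\<^sup>2 * card B"
proof -
  let ?f = "\<lambda>(u::nat, v) H. insert {u, v} H"
  have "card A \<le> card ({..<n} \<times> {..<n}) * card B"
  proof (rule card_le_parametrized[where f = ?f])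
    fix G assume "G \<in> A"
    then obtain u v where "u < n" "v < n" "{u, v} \<in> G" "G - {{u, v}} \<in> B"
      using assms(2) by blast
    then show "\<exists>p\<in>{..<n} \<times> {..<n}. \<exists>H\<in>B. G = ?f p H"
      by (intro bexI[of _ "(u, v)"] bexI[of _ "G - {{u, v}}"]) auto
  qed (use assms(1) in auto)
  then show ?thesis by (simp add: power2_eq_square)
qed

lemma finite_graphs_of_plus_minus: "finite (graphs_of (seqs_plus_minus D))"
  by (simp add: graphs_of_plus_minus finite_realizations)

lemma finite_graphs_of_plus_plus: "finite (graphs_of (seqs_plus_plus D))"
  by (simp add: graphs_of_plus_plus finite_realizations)

section \<open>Deleting an edge at a vertex of excess degree\<close>

lemma graphic_bounds:
  assumes "graphic D" "i < length D"
  shows "0 \<le> D ! i" "D ! i \<le> int (length D) - 1"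
proof -
  obtain H where H: "H \<subseteq> vertex_pairs (length D)" "int (degree H i) = D ! i"
    using assms unfolding graphic_def realizations_def by blast
  then show "0 \<le> D ! i" by linarith
  show "D ! i \<le> int (length D) - 1"
    using degree_le[OF H(1) assms(2)] H(2) assms(2) by linarith
qed

text \<open>As \<open>D ! i \<ge> 0\<close>, the excess guarantees an edge at \<open>i\<close>. The
  case \<open>i = j\<close> is included and serves \<open>seqs_plus_two\<close>;
  \<open>w = j\<close> may also occur, and then the result realizes \<open>D\<close>.\<close>

lemma delete_edge_at_excess:
  assumes "graphic D" "i < length D" "j < length D"
    and G: "G \<in> realizations (perturb D 1 i 1 j)"
  obtains w where "w < length D" "w \<noteq> i" "{i, w} \<in> G"
    "G - {{i, w}} \<in> realizations (perturb D 1 j (-1) w)"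
proof -
  have sub: "G \<subseteq> vertex_pairs (length D)"
    and deg: "\<And>k. k < length D \<Longrightarrow>
      int (degree G k) = D ! k + (if k = i then 1 else 0) + (if k = j then 1 else 0)"
    using G by (auto simp: realizations_perturb_iff)
  have "degree G i > 0"
    using deg[OF assms(2)] graphic_bounds(1)[OF assms(1,2)] by (auto split: if_splits)
  then obtain w where w: "{i, w} \<in> G" "w < length D" "w \<noteq> i"
    by (rule degree_pos_neighbour[OF sub])
  have "G - {{i, w}} \<in> realizations (perturb D 1 j (-1) w)"
    using sub deg degree_delete[OF finite_subgraph[OF sub] w(1) w(3)[symmetric]]
    by (auto simp: realizations_perturb_iff)
  with w that show thesis by blast
qed

lemma card_plus_plus_le:
  assumes "graphic D"
  shows "card (graphs_of (seqs_plus_plus D))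
    \<le> (length D)\<^sup>2 * (card (graphs_of (seqs_plus_minus D)) + card (realizations D))"
proof -
  let ?B = "graphs_of (seqs_plus_minus D) \<union> realizations D"
  \<comment> \<open>This covers deletion of the edge \<open>{i, j}\<close> itself, where both
    excesses vanish; it is the source of the summand \<open>card (realizations D)\<close>.\<close>
  have cancel: "realizations (perturb D 1 j (-1) j) \<subseteq> realizations D" for j
    unfolding subset_iff realizations_perturb_iff by (auto simp: realizations_def)
  have "card (graphs_of (seqs_plus_plus D)) \<le> (length D)\<^sup>2 * card ?B"
  proof (rule card_le_delete_edge)
    show "finite ?B"
      by (simp add: finite_graphs_of_plus_minus finite_realizations)
    fix G assume "G \<in> graphs_of (seqs_plus_plus D)"
    then obtain i j where ij: "i < length D" "j < length D" "i \<noteq> j"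
      "G \<in> realizations (perturb D 1 i 1 j)"
      by (auto simp: graphs_of_plus_plus)
    obtain w where w: "w < length D" "w \<noteq> i" "{i, w} \<in> G"
      "G - {{i, w}} \<in> realizations (perturb D 1 j (-1) w)"
      by (rule delete_edge_at_excess[OF assms ij(1,2,4)])
    have "G - {{i, w}} \<in> ?B"
    proof (cases "w = j")
      case True
      then show ?thesis using w(4) cancel by blast
    next
      case False
      then show ?thesis using w ij by (auto simp: graphs_of_plus_minus)
    qed
    then show "\<exists>u<length D. \<exists>v<length D. {u, v} \<in> G \<and> G - {{u, v}} \<in> ?B"
      using ij w by blast
  qed
  also have "\<dots> \<le> (length D)\<^sup>2 * (card (graphs_of (seqs_plus_minus D)) + card (realizations D))"
    by (intro mult_left_mono card_Un_le) simp
  finally show ?thesis .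
qed

text \<open>With both units of excess at \<open>i\<close>, the other end \<open>w \<noteq> i\<close>
  of the deleted edge always carries a deficit, so realizations of \<open>D\<close> do not enter the
  bound.\<close>

lemma card_plus_two_le:
  assumes "graphic D"
  shows "card (graphs_of (seqs_plus_two D)) \<le> (length D)\<^sup>2 * card (graphs_of (seqs_plus_minus D))"
proof (rule card_le_delete_edge[OF finite_graphs_of_plus_minus])
  fix G assume "G \<in> graphs_of (seqs_plus_two D)"
  then obtain i where i: "i < length D" "G \<in> realizations (perturb D 1 i 1 i)"
    by (auto simp: graphs_of_plus_two)
  obtain w where w: "w < length D" "w \<noteq> i" "{i, w} \<in> G"
    "G - {{i, w}} \<in> realizations (perturb D 1 i (-1) w)"
    by (rule delete_edge_at_excess[OF assms i(1,1,2)])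
  then have "G - {{i, w}} \<in> graphs_of (seqs_plus_minus D)"
    using i by (auto simp: graphs_of_plus_minus)
  then show "\<exists>u<length D. \<exists>v<length D. {u, v} \<in> G \<and> G - {{u, v}} \<in> graphs_of (seqs_plus_minus D)"
    using i w by blast
qed

section \<open>From one excess and one deficit to two excesses\<close>

lemma plus_two_non_full_neighbour:
  assumes "graphic D" "i < length D" and G: "G \<in> realizations (perturb D 1 i 1 i)"
  obtains w x where "w < length D" "x < length D" "w \<noteq> i" "x \<noteq> w" "x \<noteq> i"
    "{i, w} \<in> G" "{w, x} \<notin> G"
proof (rule ccontr)
  assume no: "\<not> thesis"
  note found = that
  \<comment> \<open>The negated conclusion yields this only for \<open>x \<noteq> i\<close>; for
    \<open>x = i\<close> it is the given edge \<open>{i, w}\<close>. Hence \<open>w\<close> is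
    joined to all other vertices.\<close>
  have full: "{w, x} \<in> G"
    if wx: "w < length D" "x < length D" "w \<noteq> i" "x \<noteq> w" "{i, w} \<in> G" for w x
  proof (cases "x = i")
    case True
    then show ?thesis using wx(5) by (simp add: insert_commute)
  next
    case False
    then show ?thesis using found[of w x] wx no by blast
  qed
  have sub: "G \<subseteq> vertex_pairs (length D)"
    and deg: "\<And>k. k < length D \<Longrightarrow> int (degree G k) = D ! k + (if k = i then 2 else 0)"
    using G by (auto simp: realizations_perturb_iff)
  obtain H where H: "H \<subseteq> vertex_pairs (length D)"
    "\<And>k. k < length D \<Longrightarrow> int (degree H k) = D ! k"
    using assms(1) unfolding graphic_def realizations_def by blast
  \<comment> \<open>The two degree sequences differ only at \<open>i\<close>, so a neighbour
    \<open>w\<close> of full degree in \<open>G\<close> has full degree in \<open>H\<close> and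
    stays joined to \<open>i\<close>.\<close>
  have "{e \<in> G. i \<in> e} \<subseteq> {e \<in> H. i \<in> e}"
  proof safe
    fix e assume e: "e \<in> G" "i \<in> e"
    then obtain w where w: "e = {i, w}" "w < length D" "w \<noteq> i"
      using sub by (meson subsetD vertex_pairs_other_end)
    then have "degree G w = length D - 1"
      using full_degree_iff[OF sub w(2)] full e by auto
    then have "degree H w = length D - 1"
      using deg[OF w(2)] H(2)[OF w(2)] w(3) by simp
    then show "e \<in> H"
      using full_degree_iff[OF H(1) w(2)] w assms(2) by (metis insert_commute)
  qed
  then have "degree G i \<le> degree H i"
    unfolding degree_def using finite_subgraph[OF H(1)] by (intro card_mono) auto
  then show False
    using deg[OF assms(2)] H(2)[OF assms(2)] by simp
qed

text \<open>The term \<open>n\<^sup>2\<close> counts the ends \<open>(j, k)\<close> of a single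
  added edge, \<open>n ^ 4\<close> the vertices \<open>(i, w, x, j)\<close> of the longer
  modification.\<close>

lemma card_plus_minus_le:
  assumes "graphic D" and n: "length D = n"
  shows "card (graphs_of (seqs_plus_minus D)) \<le> (n ^ 4 + n\<^sup>2) * card (graphs_of (seqs_plus_plus D))"
proof -
  let ?A = "graphs_of (seqs_plus_minus D)" and ?B = "graphs_of (seqs_plus_plus D)"
  let ?N = "{..<n}"
  \<comment> \<open>The decoders undo the modifications in reverse order: \<open>?g\<close> removes
    \<open>{w, x}\<close>, restores \<open>{i, w}\<close> and removes \<open>{i, j}\<close>.\<close>
  let ?f = "\<lambda>(j::nat, k) H. H - {{j, k}}"
  let ?g = "\<lambda>(i::nat, w, x, j) H. insert {i, w} (H - {{w, x}}) - {{i, j}}"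
  \<comment> \<open>The split is by decodability through \<open>?f\<close>, so lying outside
    \<open>A1\<close> directly excludes every non-neighbour \<open>k \<noteq> i\<close> of
    \<open>j\<close>.\<close>
  define A1 where "A1 = {G \<in> ?A. \<exists>p\<in>?N \<times> ?N. \<exists>H\<in>?B. G = ?f p H}"
  have "card A1 \<le> card (?N \<times> ?N) * card ?B"
    by (rule card_le_parametrized[where f = ?f]) (auto simp: A1_def finite_graphs_of_plus_plus)
  moreover have "card (?A - A1) \<le> card (?N \<times> ?N \<times> ?N \<times> ?N) * card ?B"
  proof (rule card_le_parametrized[where f = ?g])
    fix G assume "G \<in> ?A - A1"
    then obtain i j where ij: "i < n" "j < n" "i \<noteq> j" "G \<in> realizations (perturb D 1 i (-1) j)"
      and not1: "\<not> (\<exists>p\<in>?N \<times> ?N. \<exists>H\<in>?B. G = ?f p H)"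
      unfolding A1_def graphs_of_plus_minus by (auto simp: n)
    have sub: "G \<subseteq> vertex_pairs n"
      and deg: "\<And>k. k < n \<Longrightarrow>
        int (degree G k) = D ! k + (if k = i then 1 else 0) - (if k = j then 1 else 0)"
      using ij(4) by (auto simp: realizations_perturb_iff n)
    have nbrs: "{j, k} \<in> G" if k: "k < n" "k \<noteq> i" "k \<noteq> j" for k
    proof (rule ccontr)
      assume new: "{j, k} \<notin> G"
      have "insert {j, k} G \<in> realizations (perturb D 1 i 1 k)"
        using sub deg ij k degree_insert[OF finite_subgraph[OF sub] new k(3)[symmetric]]
        by (auto simp: realizations_perturb_iff n)
      then have "insert {j, k} G \<in> ?B"
        using ij k by (auto simp: graphs_of_plus_plus n)
      moreover have "G = ?f (j, k) (insert {j, k} G)"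
        using new by auto
      ultimately show False
        using not1 ij k by blast
    qed
    \<comment> \<open>The deficit leaves \<open>j\<close> with degree at most \<open>n - 2\<close>,
      so a non-neighbour exists; by \<open>nbrs\<close> it must be \<open>i\<close>.\<close>
    have "degree G j \<noteq> n - 1"
      using deg[OF ij(2)] graphic_bounds(2)[OF assms(1), of j] ij(2,3) n by auto
    then have "\<not> (\<forall>u<n. u \<noteq> j \<longrightarrow> {j, u} \<in> G)"
      using full_degree_iff[OF sub ij(2)] by blast
    then have new: "{i, j} \<notin> G"
      using nbrs by (metis insert_commute)
    define G1 where "G1 = insert {i, j} G"
    have sub1: "G1 \<subseteq> vertex_pairs n"
      and deg1: "\<And>k. k < n \<Longrightarrow> int (degree G1 k) = D ! k + (if k = i then 2 else 0)"
      using sub ij deg degree_insert[OF finite_subgraph[OF sub] new ij(3)] by (auto simp: G1_def)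
    then have "G1 \<in> realizations (perturb D 1 i 1 i)"
      by (auto simp: realizations_perturb_iff n)
    then obtain w x where wx: "w < n" "x < n" "w \<noteq> i" "x \<noteq> w" "x \<noteq> i" "{i, w} \<in> G1" "{w, x} \<notin> G1"
      using plus_two_non_full_neighbour[OF assms(1), of i G1] ij(1) n by metis
    define G2 where "G2 = G1 - {{i, w}}"
    have sub2: "G2 \<subseteq> vertex_pairs n" and new2: "{w, x} \<notin> G2" and w2: "w \<noteq> x"
      using sub1 wx by (auto simp: G2_def)
    have deg2: "int (degree G2 k) = D ! k + (if k = i then 1 else 0) - (if k = w then 1 else 0)"
      if "k < n" for k
      using deg1[OF that] degree_delete[OF finite_subgraph[OF sub1] wx(6) wx(3)[symmetric], of k]
      by (auto simp: G2_def)
    define H where "H = insert {w, x} G2"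
    \<comment> \<open>Adding \<open>{w, x}\<close> repays the deficit at \<open>w\<close> and puts
      an excess at \<open>x\<close>; since \<open>x \<noteq> i\<close>, the sequence lies in
      \<open>seqs_plus_plus\<close>, not \<open>seqs_plus_two\<close>.\<close>
    have "H \<in> realizations (perturb D 1 i 1 x)"
      using sub2 deg2 wx degree_insert[OF finite_subgraph[OF sub2] new2 w2]
      by (auto simp: realizations_perturb_iff n H_def)
    then have "H \<in> ?B"
      using ij wx by (auto simp: graphs_of_plus_plus n)
    moreover have "G = ?g (i, w, x, j) H"
    proof -
      have "H - {{w, x}} = G2" using new2 by (auto simp: H_def)
      moreover have "insert {i, w} G2 = G1" using wx(6) by (auto simp: G2_def)
      moreover have "G1 - {{i, j}} = G" using new by (auto simp: G1_def)
      ultimately show ?thesis by simp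
    qed
    ultimately show "\<exists>p\<in>?N \<times> ?N \<times> ?N \<times> ?N. \<exists>H\<in>?B. G = ?g p H"
      using ij wx by (intro bexI[of _ "(i, w, x, j)"] bexI[of _ H]) auto
  qed (simp_all add: finite_graphs_of_plus_plus)
  moreover have "card ?A \<le> card A1 + card (?A - A1)"
    using card_Un_le[of A1 "?A - A1"] by (simp add: A1_def Un_absorb1)
  ultimately show ?thesis
    by (simp add: power2_eq_square power4_eq_xxxx algebra_simps)
qed

section \<open>Complementation and the dual bounds\<close>

definition complement_seq :: "int list \<Rightarrow> int list" where
  "complement_seq D = map (\<lambda>d. int (length D) - 1 - d) D"

lemma length_complement_seq [simp]: "length (complement_seq D) = length D"
  by (simp add: complement_seq_def)

text \<open>The sign reversal exchanges excess and deficit, so bounds on the plus families at the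
  complementary sequence become bounds on the minus families at \<open>D\<close>.\<close>

lemma complement_seq_perturb:
  "perturb (complement_seq D) s i t j = complement_seq (perturb D (- s) i (- t) j)"
  by (rule nth_equalityI) (auto simp: complement_seq_def perturb_def)

lemma complement_in_realizations:
  assumes "H \<in> realizations E"
  shows "vertex_pairs (length E) - H \<in> realizations (complement_seq E)"
proof -
  have H: "H \<subseteq> vertex_pairs (length E)" "\<And>k. k < length E \<Longrightarrow> int (degree H k) = E ! k"
    using assms by (auto simp: realizations_def)
  then have "int (degree (vertex_pairs (length E) - H) k) = complement_seq E ! k"
    if "k < length E" for k
    using that degree_Diff[OF finite_vertex_pairs H(1), of k] degree_vertex_pairs[OF that]
    by (simp add: complement_seq_def)
  then show ?thesis
    by (auto simp: realizations_def)
qed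

lemma complement_seq_involution [simp]: "complement_seq (complement_seq E) = E"
  by (simp add: complement_seq_def comp_def)

text \<open>The common length fixes one vertex set, so a single complement map, its own inverse on
  these graphs, works for the whole family. One inequality suffices, as it can be applied again to
  the complementary family.\<close>

lemma card_graphs_of_complement_le:
  assumes "\<And>E. E \<in> F \<Longrightarrow> length E = n"
  shows "card (graphs_of F) \<le> card (graphs_of (complement_seq ` F))"
proof (rule card_inj_on_le[where f = "\<lambda>H. vertex_pairs n - H"])
  show "inj_on (\<lambda>H. vertex_pairs n - H) (graphs_of F)"
    using assms by (intro inj_on_inverseI[of _ "\<lambda>H. vertex_pairs n - H"])
      (auto simp: graphs_of_def realizations_def)
  show "(\<lambda>H. vertex_pairs n - H) ` graphs_of F \<subseteq> graphs_of (complement_seq ` F)"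
    using assms complement_in_realizations by (fastforce simp: graphs_of_def)
  show "finite (graphs_of (complement_seq ` F))"
    by (rule finite_graphs_of[of _ n]) (auto simp: assms)
qed

lemma card_graphs_of_complement:
  assumes "\<And>E. E \<in> F \<Longrightarrow> length E = n"
  shows "card (graphs_of (complement_seq ` F)) = card (graphs_of F)"
proof (rule antisym)
  show "card (graphs_of (complement_seq ` F)) \<le> card (graphs_of F)"
  proof -
    have "card (graphs_of (complement_seq ` F))
        \<le> card (graphs_of (complement_seq ` complement_seq ` F))"
      by (rule card_graphs_of_complement_le[of _ n]) (auto simp: assms)
    then show ?thesis
      by (simp add: image_image)
  qed
qed (rule card_graphs_of_complement_le[OF assms])

lemma seqs_complement:
  "seqs_plus_plus (complement_seq D) = complement_seq ` seqs_minus_minus D"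
  "seqs_plus_two (complement_seq D) = complement_seq ` seqs_minus_two D"
  "seqs_plus_minus (complement_seq D) = complement_seq ` seqs_plus_minus D"
proof -
  \<comment> \<open>Complementing moves the excess to \<open>j\<close> and the deficit to
    \<open>i\<close>; renaming the two indices shows that the plus-minus family is
    preserved.\<close>
  have swap: "perturb D s i t j = perturb D t j s i" for s t i j
    by (auto simp: perturb_def)
  show "seqs_plus_plus (complement_seq D) = complement_seq ` seqs_minus_minus D"
    and "seqs_plus_two (complement_seq D) = complement_seq ` seqs_minus_two D"
    by (auto simp: seqs_plus_plus_def seqs_minus_minus_def seqs_plus_two_def seqs_minus_two_def
        complement_seq_perturb)
  have "seqs_plus_minus (complement_seq D)
      = complement_seq ` {perturb D (-1) i 1 j | i j. i < length D \<and> j < length D \<and> i \<noteq> j}"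
    by (auto simp: seqs_plus_minus_def complement_seq_perturb)
  also have "{perturb D (-1) i 1 j | i j. i < length D \<and> j < length D \<and> i \<noteq> j} = seqs_plus_minus D"
    unfolding seqs_plus_minus_def by (subst swap) blast
  finally show "seqs_plus_minus (complement_seq D) = complement_seq ` seqs_plus_minus D" .
qed

lemma card_complement:
  "card (graphs_of (seqs_plus_plus (complement_seq D))) = card (graphs_of (seqs_minus_minus D))"
  "card (graphs_of (seqs_plus_two (complement_seq D))) = card (graphs_of (seqs_minus_two D))"
  "card (graphs_of (seqs_plus_minus (complement_seq D))) = card (graphs_of (seqs_plus_minus D))"
  "card (realizations (complement_seq D)) = card (realizations D)"
proof -
  show "card (realizations (complement_seq D)) = card (realizations D)"
    using card_graphs_of_complement[of "{D}" "length D"] by (simp add: graphs_of_def)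
qed (unfold seqs_complement, rule card_graphs_of_complement[of _ "length D"];
    auto simp: seqs_minus_minus_def seqs_minus_two_def seqs_plus_minus_def)+

theorem theorem6p2:
  fixes D :: "int list" and n :: nat
  assumes "length D = n" and "graphic D"
  shows "max (card (graphs_of (seqs_plus_plus D))) (card (graphs_of (seqs_minus_minus D)))
           \<le> n\<^sup>2 * (card (graphs_of (seqs_plus_minus D)) + card (realizations D))
       \<and> max (card (graphs_of (seqs_plus_two D))) (card (graphs_of (seqs_minus_two D)))
           \<le> n\<^sup>2 * card (graphs_of (seqs_plus_minus D))
       \<and> card (graphs_of (seqs_plus_minus D))
           \<le> (n ^ 4 + n\<^sup>2) *
              min (card (graphs_of (seqs_plus_plus D))) (card (graphs_of (seqs_minus_minus D)))"
proof -
  have graphic': "graphic (complement_seq D)"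
    using assms(2) complement_in_realizations by (fastforce simp: graphic_def)
  note direct = card_plus_plus_le[OF assms(2)] card_plus_two_le[OF assms(2)]
    card_plus_minus_le[OF assms(2,1)]
  have len': "length (complement_seq D) = n"
    using assms(1) by simp
  \<comment> \<open>The same three bounds at the complementary sequence;
    \<open>card_complement\<close> translates them back to \<open>D\<close>.\<close>
  note dual = card_plus_plus_le[OF graphic'] card_plus_two_le[OF graphic']
    card_plus_minus_le[OF graphic' len']
  show ?thesis
    using direct dual unfolding card_complement length_complement_seq assms(1)
    by (simp add: min_def)
qed

end
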